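(* An $LC^*$-algebra $A$ is $C^*$-barrelled if and only if both of the following conditions hold: (a) $X_c^*(A)$ is $k$-closed in $X^*(A)$; (b) the topology of $A$ is the topology of uniform convergence on all compact subsets of $X_c^*(A)$.
   Context: "Algebra" means commutative associative algebra over $\mathbb{C}$ with unit. An involutive algebra is an algebra with a conjugate-linear map $x\mapsto x^*$ satisfying $(x^* )^*=x$, $(xy)^*=y^*x^*$. A hermitian character is a unit-preserving algebra homomorphism $\chi\colon A\to\mathbb{C}$ with $\chi(x^* )=\overline{\chi(x)}$. A $C^*$-seminorm on $A$ is a seminorm $p$ with $p(xx^* )=p(x)^2$ for all $x$. An $LC^*$-algebra is an involutive algebra with a topology defined by a family of $C^*$-seminorms (not necessarily Hausdorff). An $LC^*$-algebra is $C^*$-barrelled if every lower semicontinuous $C^*$-seminorm on it is continuous. $X^*(A)$ is the set of all hermitian characters of $A$ with the topology of pointwise convergence on $A$; $X_c^*(A)$ is the subspace of continuous ones. A subset $S$ of a topological space $T$ is $k$-closed if for every compact $K\subset T$ the set $S\cap K$ is closed in $K$. The topology of uniform convergence on all compact subsets of $X_c^*(A)$ is the topology generated by the seminorms $p^K(a)=\sup\{|\chi(a)|:\chi\in K\}$ with $K\subset X_c^*(A)$ compact. *)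

theory Defs
  imports "HOL-Analysis.Analysis"
begin

(* The sort {comm_ring, comm_monoid_mult} describes commutative rings with unit in which 1 = 0
   is not excluded (comm_ring_1 would exclude it), so the zero algebra is covered. *)

locale involutive_algebra = vector_space scaleC
  for scaleC :: "complex \<Rightarrow> 'a::{comm_ring, comm_monoid_mult} \<Rightarrow> 'a" +
  fixes star :: "'a \<Rightarrow> 'a"
  assumes scaleC_mult_left: "scaleC c x * y = scaleC c (x * y)"
    and star_add: "star (x + y) = star x + star y"
    and star_scaleC: "star (scaleC c x) = scaleC (cnj c) (star x)"
    and star_star: "star (star x) = x"
    and star_mult: "star (x * y) = star y * star x"

definition hermitian_character ::
    "(complex \<Rightarrow> 'a::{comm_ring, comm_monoid_mult} \<Rightarrow> 'a) \<Rightarrow> ('a \<Rightarrow> 'a) \<Rightarrow> ('a \<Rightarrow> complex) \<Rightarrow> bool"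
  where "hermitian_character scaleC star \<phi> \<longleftrightarrow>
    Vector_Spaces.linear scaleC (*) \<phi> \<and>
    (\<forall>x y. \<phi> (x * y) = \<phi> x * \<phi> y) \<and>
    \<phi> 1 = 1 \<and>
    (\<forall>x. \<phi> (star x) = cnj (\<phi> x))"

definition seminorm ::
    "(complex \<Rightarrow> 'a::ab_group_add \<Rightarrow> 'a) \<Rightarrow> ('a \<Rightarrow> real) \<Rightarrow> bool"
  where "seminorm scaleC p \<longleftrightarrow>
    (\<forall>x. 0 \<le> p x) \<and>
    (\<forall>x y. p (x + y) \<le> p x + p y) \<and>
    (\<forall>c x. p (scaleC c x) = cmod c * p x)"

definition Cstar_seminorm ::
    "(complex \<Rightarrow> 'a::{comm_ring, comm_monoid_mult} \<Rightarrow> 'a) \<Rightarrow> ('a \<Rightarrow> 'a) \<Rightarrow> ('a \<Rightarrow> real) \<Rightarrow> bool"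
  where "Cstar_seminorm scaleC star p \<longleftrightarrow>
    seminorm scaleC p \<and> (\<forall>x. p (x * star x) = (p x)\<^sup>2)"

(* The open balls of all seminorms around all points form a subbasis.  UNIV is added so that
   the empty family yields the indiscrete topology rather than one with empty topspace. *)

definition seminorm_topology :: "('a::ab_group_add \<Rightarrow> real) set \<Rightarrow> 'a topology"
  where "seminorm_topology P =
    topology_generated_by (insert UNIV {{y. p (y - x) < r} | p x r. p \<in> P \<and> 0 < r})"

definition LCstar_algebra ::
    "(complex \<Rightarrow> 'a::{comm_ring, comm_monoid_mult} \<Rightarrow> 'a) \<Rightarrow> ('a \<Rightarrow> 'a) \<Rightarrow> 'a topology \<Rightarrow> bool"
  where "LCstar_algebra scaleC star T \<longleftrightarrow>
    involutive_algebra scaleC star \<and>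
    (\<exists>P. (\<forall>p\<in>P. Cstar_seminorm scaleC star p) \<and> T = seminorm_topology P)"

definition lower_semicontinuous :: "'b topology \<Rightarrow> ('b \<Rightarrow> real) \<Rightarrow> bool"
  where "lower_semicontinuous T f \<longleftrightarrow> (\<forall>r. openin T {x \<in> topspace T. r < f x})"

definition Cstar_barrelled ::
    "(complex \<Rightarrow> 'a::{comm_ring, comm_monoid_mult} \<Rightarrow> 'a) \<Rightarrow> ('a \<Rightarrow> 'a) \<Rightarrow> 'a topology \<Rightarrow> bool"
  where "Cstar_barrelled scaleC star T \<longleftrightarrow>
    (\<forall>p. Cstar_seminorm scaleC star p \<and> lower_semicontinuous T p \<longrightarrow>
      continuous_map T euclideanreal p)"

definition character_space ::
    "(complex \<Rightarrow> 'a::{comm_ring, comm_monoid_mult} \<Rightarrow> 'a) \<Rightarrow> ('a \<Rightarrow> 'a) \<Rightarrow> ('a \<Rightarrow> complex) topology"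
  where "character_space scaleC star =
    subtopology (product_topology (\<lambda>_. euclidean) UNIV) {\<phi>. hermitian_character scaleC star \<phi>}"

definition continuous_characters ::
    "(complex \<Rightarrow> 'a::{comm_ring, comm_monoid_mult} \<Rightarrow> 'a) \<Rightarrow> ('a \<Rightarrow> 'a) \<Rightarrow> 'a topology \<Rightarrow>
     ('a \<Rightarrow> complex) set"
  where "continuous_characters scaleC star T =
    {\<phi>. hermitian_character scaleC star \<phi> \<and> continuous_map T euclidean \<phi>}"

definition continuous_character_space ::
    "(complex \<Rightarrow> 'a::{comm_ring, comm_monoid_mult} \<Rightarrow> 'a) \<Rightarrow> ('a \<Rightarrow> 'a) \<Rightarrow> 'a topology \<Rightarrow>
     ('a \<Rightarrow> complex) topology"
  where "continuous_character_space scaleC star T =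
    subtopology (character_space scaleC star) (continuous_characters scaleC star T)"

definition k_closedin :: "'b topology \<Rightarrow> 'b set \<Rightarrow> bool"
  where "k_closedin X S \<longleftrightarrow>
    S \<subseteq> topspace X \<and> (\<forall>K. compactin X K \<longrightarrow> closedin (subtopology X K) (S \<inter> K))"

(* Inserting 0 gives the value 0 for empty K, where Sup on the reals is unspecified; for
   nonempty K it changes nothing, as all moduli are nonnegative. *)

definition sup_seminorm :: "('a \<Rightarrow> complex) set \<Rightarrow> 'a \<Rightarrow> real"
  where "sup_seminorm K a = Sup (insert 0 ((\<lambda>\<phi>. cmod (\<phi> a)) ` K))"

definition compact_convergence_topology ::
    "(complex \<Rightarrow> 'a::{comm_ring, comm_monoid_mult} \<Rightarrow> 'a) \<Rightarrow> ('a \<Rightarrow> 'a) \<Rightarrow> 'a topology \<Rightarrow> 'a topology"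
  where "compact_convergence_topology scaleC star T =
    seminorm_topology {sup_seminorm K | K. compactin (continuous_character_space scaleC star T) K}"

end

theory Submission
  imports Defs
begin

text \<open>Every \<open>C\<^sup>*\<close>-seminorm \<open>p\<close> is the supremum seminorm of the compact set \<open>K\<^sub>p\<close> of hermitian
  characters \<open>\<phi>\<close> with \<open>\<bar>\<phi>\<bar> \<le> p\<close>: a minimal \<open>C\<^sup>*\<close>-seminorm below \<open>p\<close> that agrees with \<open>p\<close> at a
  given element is multiplicative, hence the modulus of a character. If the algebra is barrelled,
  (a) and (b) follow since the supremum seminorm of a pointwise bounded set of continuous
  characters is lower semicontinuous. Conversely, let \<open>p\<close> be lower semicontinuous. If \<open>\<bar>\<phi>(x)\<bar> \<le> 1\<close>
  for the continuous characters \<open>\<phi>\<close> in \<open>K\<^sub>p\<close>, then for each continuous \<open>C\<^sup>*\<close>-seminorm \<open>q\<close> the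
  Stone--Weierstrass theorem on \<open>K\<^sub>p \<union> K\<^sub>q\<close> gives elements that are \<open>q\<close>-close to \<open>x\<close> and on which \<open>p\<close>
  is nearly bounded by 1, so \<open>p x \<le> 1\<close>. Thus \<open>p\<close> is the supremum seminorm of the set of continuous
  characters in \<open>K\<^sub>p\<close>, which is compact by (a), and \<open>p\<close> is continuous by (b).\<close>

section \<open>Gelfand theory of C*-seminorms\<close>

lemma seminormD:
  assumes "seminorm s p"
  shows seminorm_nonneg: "0 \<le> p x" and seminorm_triangle: "p (x + y) \<le> p x + p y"
    and seminorm_scale: "p (s c x) = cmod c * p x"
  using assms by (auto simp: seminorm_def)

lemma Cstar_seminormD:
  assumes "Cstar_seminorm s st p"
  shows Cstar_seminorm_seminorm: "seminorm s p" and Cstar_seminorm_square: "p (x * st x) = (p x)\<^sup>2"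
  using assms by (auto simp: Cstar_seminorm_def)

lemmas Cstar_seminorm_nonneg = seminorm_nonneg[OF Cstar_seminorm_seminorm]
  and Cstar_seminorm_triangle = seminorm_triangle[OF Cstar_seminorm_seminorm]
  and Cstar_seminorm_scale = seminorm_scale[OF Cstar_seminorm_seminorm]

context involutive_algebra
begin

lemma scaleC_mult_right: "x * scaleC c y = scaleC c (x * y)"
  by (metis mult.commute scaleC_mult_left)

lemma star_diff: "star (x - y) = star x - star y"
  using star_add[of "x - y" y] by (simp add: algebra_simps)

lemma star_one: "star 1 = 1"
  using star_mult[of "star 1" 1] by (simp add: star_star)

lemma star_power: "star (x ^ n) = star x ^ n"
  by (induction n) (simp_all add: star_one star_mult mult.commute)

lemma seminorm_zero: "seminorm scaleC p \<Longrightarrow> p 0 = 0"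
  using seminorm_scale[of scaleC p 0 0] by simp

lemma seminorm_minus: "seminorm scaleC p \<Longrightarrow> p (- x) = p x"
  using seminorm_scale[of scaleC p "-1" x] by simp

lemma seminorm_diff_triangle: "seminorm scaleC p \<Longrightarrow> p (x - y) \<le> p x + p y"
  using seminorm_triangle[of scaleC p x "- y"] by (simp add: seminorm_minus)

lemma seminorm_minus_commute: "seminorm scaleC p \<Longrightarrow> p (x - y) = p (y - x)"
  using seminorm_minus[of p "x - y"] by simp

lemma seminorm_diff_abs: 
  assumes "seminorm scaleC p" shows "\<bar>p x - p y\<bar> \<le> p (x - y)"
  using seminorm_triangle[OF assms, of "x - y" y] seminorm_triangle[OF assms, of "y - x" x]
    seminorm_minus_commute[OF assms, of x y] by (simp add: algebra_simps)

section \<open>Submultiplicativity of C*-seminorms\<close>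

lemma Cstar_seminorm_power2:
  assumes "Cstar_seminorm scaleC star p" "star h = h"
  shows "p (h ^ 2 ^ n) = p h ^ 2 ^ n"
proof (induction n)
  case (Suc n)
  have "p (h ^ 2 ^ n * star (h ^ 2 ^ n)) = (p (h ^ 2 ^ n))\<^sup>2"
    by (rule Cstar_seminorm_square[OF assms(1)])
  then show ?case
    by (simp add: star_power assms(2) Suc mult_2 power_add power2_eq_square)
qed simp

text \<open>Polarization gives submultiplicativity up to the factor 2; the factor disappears on passing
  to the powers \<open>2 ^ n\<close>.\<close>

lemma Cstar_seminorm_mult_selfadjoint_weak:
  assumes p: "Cstar_seminorm scaleC star p" and h: "star h = h" and k: "star k = k"
  shows "p (h * k) \<le> 2 * (p h * p k)"
proof -
  note sn = Cstar_seminorm_seminorm[OF p]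
  have base: "2 * p (h * k) \<le> (p h + p k)\<^sup>2" if h: "star h = h" and k: "star k = k" for h k
  proof -
    have dbl: "p (z + z) = 2 * p z" for z
      using seminorm_scale[OF sn, of 2 z] scale_left_distrib[of 1 1 z] by simp
    have "4 * p (h * k) = p ((h * k + h * k) + (h * k + h * k))"
      by (simp only: dbl)
    also have "(h * k + h * k) + (h * k + h * k) = (h + k) * star (h + k) - (h - k) * star (h - k)"
      by (simp add: star_add star_diff h k algebra_simps)
    also have "p \<dots> \<le> (p (h + k))\<^sup>2 + (p (h - k))\<^sup>2"
      using seminorm_diff_triangle[OF sn] Cstar_seminorm_square[OF p] by metis
    also have "\<dots> \<le> (p h + p k)\<^sup>2 + (p h + p k)\<^sup>2"
      by (intro add_mono power_mono seminorm_triangle[OF sn] seminorm_diff_triangle[OF sn]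
        seminorm_nonneg[OF sn])
    finally show ?thesis by simp
  qed
  \<comment> \<open>Normalizing \<open>h\<close> and \<open>k\<close> by \<open>p h + e\<close> and
    \<open>p k + e\<close> also covers the case where one of the seminorms is zero; afterwards
    \<open>e\<close> tends to 0.\<close>
  have e: "p (h * k) \<le> 2 * ((p h + e) * (p k + e))" if "0 < e" for e
  proof -
    define a b where "a = p h + e" and "b = p k + e"
    have ab: "0 < a" "0 < b" "p h \<le> a" "p k \<le> b"
      using seminorm_nonneg[OF sn, of h] seminorm_nonneg[OF sn, of k] that by (auto simp: a_def b_def)
    have "p (scaleC (of_real (1 / a)) h * scaleC (of_real (1 / b)) k) = p (h * k) / (a * b)"
      using ab by (simp add: scaleC_mult_left scaleC_mult_right seminorm_scale[OF sn] norm_divide norm_mult)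
    moreover have "2 * p (scaleC (of_real (1 / a)) h * scaleC (of_real (1 / b)) k) \<le> (p h / a + p k / b)\<^sup>2"
      using base[of "scaleC (of_real (1 / a)) h" "scaleC (of_real (1 / b)) k"] ab
      by (simp add: star_scaleC h k seminorm_scale[OF sn] norm_divide)
    moreover have "(p h / a + p k / b)\<^sup>2 \<le> (1 + 1)\<^sup>2"
      using ab seminorm_nonneg[OF sn] by (intro power_mono add_mono) auto
    ultimately have "p (h * k) / (a * b) \<le> 2" by simp
    then have "p (h * k) \<le> 2 * (a * b)" using ab by (simp add: divide_le_eq)
    then show ?thesis by (simp only: a_def b_def)
  qed
  have "((\<lambda>e. 2 * ((p h + e) * (p k + e))) \<longlongrightarrow> 2 * ((p h + 0) * (p k + 0))) (at_right 0)"
    by (intro tendsto_intros)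
  then have "p (h * k) \<le> 2 * ((p h + 0) * (p k + 0))"
    by (rule tendsto_lowerbound) (auto simp: eventually_at_right_less e intro!: eventually_mono[OF eventually_at_right_less])
  then show ?thesis by simp
qed

lemma Cstar_seminorm_mult_selfadjoint:
  assumes p: "Cstar_seminorm scaleC star p" and h: "star h = h" and k: "star k = k"
  shows "p (h * k) \<le> p h * p k"
proof (rule ccontr)
  assume "\<not> ?thesis"
  then have less: "p h * p k < p (h * k)" by simp
  have hk: "star (h * k) = h * k" by (simp add: star_mult h k mult.commute)
  have le: "p (h * k) ^ 2 ^ n \<le> 2 * (p h * p k) ^ 2 ^ n" for n
    using Cstar_seminorm_mult_selfadjoint_weak[OF p, of "h ^ 2 ^ n" "k ^ 2 ^ n"]
    by (simp add: star_power h k power_mult_distrib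
        Cstar_seminorm_power2[OF p h] Cstar_seminorm_power2[OF p k]
        flip: Cstar_seminorm_power2[OF p hk])
  have "p h * p k \<noteq> 0"
    using Cstar_seminorm_mult_selfadjoint_weak[OF p h k] less by auto
  then have pos: "0 < p h * p k"
    using Cstar_seminorm_nonneg[OF p] by (simp add: less_le)
  \<comment> \<open>The ratio exceeds 1, so its powers outgrow the constant 2.\<close>
  then obtain n where n: "2 < (p (h * k) / (p h * p k)) ^ n"
    using real_arch_pow[of "p (h * k) / (p h * p k)" 2] less by auto
  also have "\<dots> \<le> (p (h * k) / (p h * p k)) ^ 2 ^ n"
    using less pos by (intro power_increasing) (auto simp: less_imp_le)
  also have "\<dots> \<le> 2"
    using le[of n] pos by (simp only: power_divide divide_le_eq) simp
  finally show False by simp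
qed

text \<open>By commutativity \<open>(x * y) * star (x * y)\<close> is the product of the selfadjoint
  elements \<open>x * star x\<close> and \<open>y * star y\<close>, so the C*-identity reduces
  everything to the selfadjoint case.\<close>

lemma Cstar_seminorm_mult:
  assumes p: "Cstar_seminorm scaleC star p"
  shows "p (x * y) \<le> p x * p y"
proof -
  have "(p (x * y))\<^sup>2 = p ((x * star x) * (y * star y))"
    by (simp add: Cstar_seminorm_square[OF p, symmetric] star_mult mult_ac)
  also have "\<dots> \<le> p (x * star x) * p (y * star y)"
    by (rule Cstar_seminorm_mult_selfadjoint[OF p]) (simp_all add: star_mult star_star mult.commute)
  also have "\<dots> = (p x * p y)\<^sup>2"
    by (simp add: Cstar_seminorm_square[OF p] power_mult_distrib)
  finally show ?thesis
    by (rule power2_le_imp_le) (simp add: Cstar_seminorm_nonneg[OF p])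
qed

lemma Cstar_seminorm_star:
  assumes p: "Cstar_seminorm scaleC star p"
  shows "p (star x) = p x"
proof -
  have "(p (star x))\<^sup>2 = (p x)\<^sup>2"
    using Cstar_seminorm_square[OF p, of x] Cstar_seminorm_square[OF p, of "star x"]
    by (simp add: star_star mult.commute)
  then show ?thesis
    using Cstar_seminorm_nonneg[OF p] by (simp add: power2_eq_iff_nonneg)
qed

section \<open>Localization at elements of norm one and minimal C*-seminorms\<close>

lemma Cstar_seminorm_one_le:
  assumes p: "Cstar_seminorm scaleC star p"
  shows "p 1 \<le> 1"
proof -
  have "p 1 * p 1 = p 1"
    using Cstar_seminorm_square[OF p, of 1] by (simp add: star_one power2_eq_square)
  \<comment> \<open>The value is 0 or 1; it is 0 exactly when \<open>p\<close> vanishes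
    identically.\<close>
  then show ?thesis by (auto simp: mult_cancel_right1)
qed

text \<open>The exponents \<open>2 ^ n\<close> are settled by the C*-identity. Since
  \<open>w ^ n\<close> divides \<open>w ^ 2 ^ n\<close> with a cofactor of seminorm at most 1, no
  power in between can drop below 1.\<close>

lemma Cstar_seminorm_power_eq_1:
  assumes p: "Cstar_seminorm scaleC star p" and w: "star w = w" "p w = 1"
  shows "p (w ^ n) = 1"
proof (rule antisym)
  have le: "p (w ^ n) \<le> 1" for n
  proof (induction n)
    case (Suc n)
    then show ?case using Cstar_seminorm_mult[OF p, of w "w ^ n"] w by simp
  qed (simp add: Cstar_seminorm_one_le[OF p])
  then show "p (w ^ n) \<le> 1" .
  have "1 = p (w ^ 2 ^ n)"
    using Cstar_seminorm_power2[OF p w(1)] w(2) by simp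
  also have "w ^ 2 ^ n = w ^ n * w ^ (2 ^ n - n)"
    by (simp flip: power_add)
  also have "p \<dots> \<le> p (w ^ n) * p (w ^ (2 ^ n - n))"
    by (rule Cstar_seminorm_mult[OF p])
  also have "\<dots> \<le> p (w ^ n)"
    using le Cstar_seminorm_nonneg[OF p] by (simp add: mult_left_le)
  finally show "1 \<le> p (w ^ n)" .
qed

text \<open>For the supremum seminorm of a compact set this replaces the set by its part where
  \<open>\<bar>w\<bar> = 1\<close>.\<close>

lemma Cstar_seminorm_localization:
  assumes q: "Cstar_seminorm scaleC star q" and w: "star w = w" "q w = 1"
  obtains r where "Cstar_seminorm scaleC star r" "r \<le> q" "\<And>x. r (w * x) = r x"
    "\<forall>x c. (\<forall>n. q (x * w ^ n) = c) \<longrightarrow> r x = c"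
proof
  define r where "r x = lim (\<lambda>n. q (x * w ^ n))" for x
  have dec: "decseq (\<lambda>n. q (x * w ^ n))" for x
  proof (rule decseq_SucI)
    fix n
    have "q (x * w ^ Suc n) = q ((x * w ^ n) * w)" by (simp add: mult_ac)
    also have "\<dots> \<le> q (x * w ^ n)" using Cstar_seminorm_mult[OF q, of "x * w ^ n" w] w by simp
    finally show "q (x * w ^ Suc n) \<le> q (x * w ^ n)" .
  qed
  have lim: "(\<lambda>n. q (x * w ^ n)) \<longlonglongrightarrow> r x" for x
  proof -
    have "convergent (\<lambda>n. q (x * w ^ n))"
      by (rule decseq_convergent[OF dec[of x], of 0]) (auto simp: Cstar_seminorm_nonneg[OF q] convergent_def)
    then show ?thesis by (simp add: r_def convergent_LIMSEQ_iff)
  qed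
  have eq: "r x = c" if "(\<lambda>n. q (x * w ^ n)) \<longlonglongrightarrow> c" for x c
    using LIMSEQ_unique[OF lim that] .
  have "0 \<le> r x" for x
    using lim by (rule LIMSEQ_le_const) (simp add: Cstar_seminorm_nonneg[OF q])
  moreover have "r (x + y) \<le> r x + r y" for x y
    by (rule LIMSEQ_le[OF lim tendsto_add[OF lim lim]])
      (auto simp: distrib_right Cstar_seminorm_triangle[OF q])
  moreover have "r (scaleC c x) = cmod c * r x" for c x
    by (rule eq) (simp add: scaleC_mult_left Cstar_seminorm_scale[OF q] tendsto_mult lim)
  moreover have "r (x * star x) = (r x)\<^sup>2" for x
  proof -
    \<comment> \<open>The element is \<open>x * w ^ n\<close> times its adjoint, so the C*-identity
      passes to the limit along the even exponents.\<close>
    have "q ((x * star x) * w ^ (2 * n)) = (q (x * w ^ n))\<^sup>2" for n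
      unfolding mult_2 power_add Cstar_seminorm_square[OF q, symmetric]
      by (simp add: star_mult star_power w mult_ac)
    moreover have "(\<lambda>n. q ((x * star x) * w ^ (2 * n))) \<longlonglongrightarrow> r (x * star x)"
      using LIMSEQ_subseq_LIMSEQ[OF lim, of "\<lambda>n. 2 * n"] by (simp add: strict_mono_def o_def)
    ultimately show ?thesis
      using tendsto_power[OF lim, of x 2] LIMSEQ_unique by simp
  qed
  ultimately show "Cstar_seminorm scaleC star r"
    by (simp add: Cstar_seminorm_def seminorm_def)
  show "r \<le> q"
    using decseq_ge[OF dec lim, of _ 0] by (auto simp: le_fun_def)
  show "r (w * x) = r x" for x
    \<comment> \<open>Multiplying by \<open>w\<close> only shifts the sequence by one.\<close>
    using LIMSEQ_Suc[OF lim, of x] by (intro eq) (simp add: mult_ac)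
  show "\<forall>x c. (\<forall>n. q (x * w ^ n) = c) \<longrightarrow> r x = c"
    by (auto intro: eq)
qed

text \<open>Zorn's lemma: the pointwise infimum of a nonempty chain of C*-seminorms below
  \<open>p\<close> that agree with \<open>p\<close> at \<open>h\<close> is again one of
  them.\<close>

lemma Cstar_seminorm_minimal:
  assumes p: "Cstar_seminorm scaleC star p"
  obtains q where "Cstar_seminorm scaleC star q" "q \<le> p" "q h = p h"
    "\<And>r. Cstar_seminorm scaleC star r \<Longrightarrow> r \<le> q \<Longrightarrow> r h = p h \<Longrightarrow> r = q"
proof -
  define F where "F = {q. Cstar_seminorm scaleC star q \<and> q \<le> p \<and> q h = p h}"
  \<comment> \<open>The order is reversed, so that a maximal element for it is a minimal
    seminorm.\<close>
  let ?R = "\<lambda>q r. r \<le> (q :: 'a \<Rightarrow> real)"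
  have "\<exists>m\<in>F. \<forall>a\<in>F. ?R m a \<longrightarrow> a = m"
  proof (rule predicate_Zorn)
    show "partial_order_on F (relation_of ?R F)"
      by (rule partial_order_on_relation_ofI) auto
    fix C assume "C \<in> Chains (relation_of ?R F)"
    then have CF: "C \<subseteq> F" and chain: "\<And>a b. a \<in> C \<Longrightarrow> b \<in> C \<Longrightarrow> a \<le> b \<or> b \<le> a"
      by (auto simp: Chains_def relation_of_def)
    show "\<exists>u\<in>F. \<forall>a\<in>C. ?R a u"
    proof (cases "C = {}")
      case True
      then show ?thesis using p by (auto simp: F_def)
    next
      case False
      define m where "m x = (INF q\<in>C. q x)" for x
      have C: "Cstar_seminorm scaleC star q" "q \<le> p" "q h = p h" if "q \<in> C" for q
        using that CF by (auto simp: F_def)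
      have nn: "0 \<le> q x" if "q \<in> C" for q x
        using Cstar_seminorm_nonneg[OF C(1)[OF that]] .
      have bdd: "bdd_below ((\<lambda>q. q x) ` C)" for x
        by (rule bdd_belowI[of _ 0]) (auto simp: nn)
      have le: "m x \<le> q x" if "q \<in> C" for q x
        unfolding m_def by (rule cINF_lower[OF bdd that])
      have ge: "b \<le> m x" if "\<And>q. q \<in> C \<Longrightarrow> b \<le> q x" for b x
        unfolding m_def by (rule cINF_greatest[OF False that])
      have approx: "\<exists>q\<in>C. q x < m x + e" if "0 < e" for x e
        using cINF_less_iff[OF False bdd, of x "m x + e"] that by (simp add: m_def)
      have m0: "0 \<le> m x" for x by (rule ge) (rule nn)
      have "m (x + y) \<le> m x + m y" for x y
      proof (rule field_le_epsilon)
        fix e :: real assume "0 < e"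
        then obtain q r where qr: "q \<in> C" "q x < m x + e / 2" "r \<in> C" "r y < m y + e / 2"
          using approx[of "e / 2"] by (meson half_gt_zero)
        \<comment> \<open>The two seminorms are comparable, and the smaller one serves both
          \<open>x\<close> and \<open>y\<close>. This is where the chain condition enters; an
          infimum of arbitrary seminorms need not be subadditive.\<close>
        have "\<exists>s\<in>C. s x \<le> q x \<and> s y \<le> r y"
          using chain[OF qr(1,3)] qr by (auto simp: le_fun_def)
        then obtain s where s: "s \<in> C" "s x \<le> q x" "s y \<le> r y" by auto
        have "m (x + y) \<le> s x + s y"
          using le[OF s(1)] Cstar_seminorm_triangle[OF C(1)[OF s(1)]] order_trans by blast
        then show "m (x + y) \<le> m x + m y + e"
          using s qr by simp
      qed
      moreover have "m (scaleC c x) = cmod c * m x" for c x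
      proof (rule antisym)
        show "cmod c * m x \<le> m (scaleC c x)"
          by (rule ge) (simp add: Cstar_seminorm_scale[OF C(1)] mult_left_mono le)
        show "m (scaleC c x) \<le> cmod c * m x"
        proof (cases "c = 0")
          case True
          moreover obtain q where q: "q \<in> C" using False by auto
          ultimately show ?thesis
            using le[OF q, of "scaleC c x"] by (simp add: seminorm_zero Cstar_seminorm_seminorm[OF C(1)[OF q]])
        next
          case False
          have "m (scaleC c x) / cmod c \<le> m x"
          proof (rule ge)
            fix q assume "q \<in> C"
            then show "m (scaleC c x) / cmod c \<le> q x"
              using False le[of q "scaleC c x"] Cstar_seminorm_scale[OF C(1), of q c x]
                by (simp add: pos_divide_le_eq mult.commute)
          qed
          then show ?thesis using False by (simp add: field_simps)
        qed
      qed
      moreover have "m (x * star x) = (m x)\<^sup>2" for x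
      proof (rule antisym)
        show "(m x)\<^sup>2 \<le> m (x * star x)"
          by (rule ge) (simp add: Cstar_seminorm_square[OF C(1)] power_mono le m0)
        \<comment> \<open>With the root on the left, the claim is a lower bound for every member of
          \<open>C\<close>.\<close>
        have "sqrt (m (x * star x)) \<le> m x"
        proof (rule ge)
          fix q assume "q \<in> C"
          then have "m (x * star x) \<le> (q x)\<^sup>2"
            using le Cstar_seminorm_square[OF C(1)] by metis
          then show "sqrt (m (x * star x)) \<le> q x"
            using nn \<open>q \<in> C\<close> real_le_lsqrt m0 by blast
        qed
        then show "m (x * star x) \<le> (m x)\<^sup>2"
          using sqrt_le_D by blast
      qed
      moreover have "m h = p h"
      proof (rule antisym)
        obtain q where "q \<in> C" using False by auto
        then show "m h \<le> p h" using le[of q h] C(3)[of q] by simp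
      qed (rule ge, simp add: C(3))
      moreover have "m \<le> p"
      proof (rule le_funI)
        obtain q where "q \<in> C" using False by auto
        then show "m x \<le> p x" for x using le[of q x] C(2)[of q] by (auto dest: le_funD[of q p x])
      qed
      ultimately have "m \<in> F"
        by (simp add: F_def Cstar_seminorm_def seminorm_def m0)
      then show ?thesis using le by (auto simp: le_fun_def)
    qed
  qed
  then obtain q where q: "q \<in> F" and min: "\<And>r. r \<in> F \<Longrightarrow> r \<le> q \<Longrightarrow> r = q" by blast
  show thesis
  proof (rule that)
    show "Cstar_seminorm scaleC star q" "q \<le> p" "q h = p h" using q by (auto simp: F_def)
    fix r assume "Cstar_seminorm scaleC star r" "r \<le> q" "r h = p h"
    then show "r = q"
      using q by (intro min) (auto simp: F_def)
  qed
qed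

text \<open>Minimality makes every localization trivial, and this forces multiplicativity.\<close>

lemma Cstar_seminorm_multiplicative:
  assumes p: "Cstar_seminorm scaleC star p" and h: "star h = h" "p h = 1"
  obtains q where "Cstar_seminorm scaleC star q" "q \<le> p" "q h = 1" "\<And>x y. q (x * y) = q x * q y"
proof -
  obtain q where q: "Cstar_seminorm scaleC star q" and qp: "q \<le> p" and qh: "q h = 1"
    and min: "\<And>r. Cstar_seminorm scaleC star r \<Longrightarrow> r \<le> q \<Longrightarrow> r h = 1 \<Longrightarrow> r = q"
    using Cstar_seminorm_minimal[OF p, of h] h by metis
  have qhx: "q (h * x) = q x" for x
  proof -
    obtain r where r: "Cstar_seminorm scaleC star r" "r \<le> q" "\<And>x. r (h * x) = r x"
      "\<forall>x c. (\<forall>n. q (x * h ^ n) = c) \<longrightarrow> r x = c"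
      using Cstar_seminorm_localization[OF q h(1) qh] by blast
    \<comment> \<open>The sequence defining \<open>r h\<close> consists of \<open>q\<close> at
      powers of \<open>h\<close>, so it is constantly 1. Hence \<open>r\<close> still competes with
      \<open>q\<close>, and minimality gives \<open>r = q\<close>.\<close>
    have "r h = 1"
      using Cstar_seminorm_power_eq_1[OF q h(1) qh, of "Suc _"] by (intro r(4)[rule_format]) simp
    then show ?thesis using min[OF r(1,2)] r(3) by simp
  qed
  have qwx: "q (w * x) = q w * q x" if w: "star w = w" for w x
  proof (cases "q w = 0")
    case True
    then show ?thesis
      using Cstar_seminorm_mult[OF q, of w x] Cstar_seminorm_nonneg[OF q, of "w * x"] by simp
  next
    case False
    then have pos: "0 < q w" using Cstar_seminorm_nonneg[OF q, of w] by simp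
    define v where "v = scaleC (of_real (1 / q w)) w"
    have v: "star v = v" "q v = 1"
      using pos by (simp_all add: v_def star_scaleC w Cstar_seminorm_scale[OF q] norm_divide)
    obtain r where r: "Cstar_seminorm scaleC star r" "r \<le> q" "\<And>x. r (v * x) = r x"
      "\<forall>x c. (\<forall>n. q (x * v ^ n) = c) \<longrightarrow> r x = c"
      using Cstar_seminorm_localization[OF q v] by blast
    \<comment> \<open>Here \<open>qhx\<close> is needed: it removes \<open>h\<close> from
      \<open>q (h * v ^ n)\<close> and leaves \<open>q (v ^ n) = 1\<close>.\<close>
    have "r h = 1"
      by (rule r(4)[rule_format]) (simp add: qhx Cstar_seminorm_power_eq_1[OF q v])
    then have "q (v * x) = q x" using min[OF r(1,2)] r(3) by simp
    then have "q (w * x) / q w = q x"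
      using pos by (simp add: v_def scaleC_mult_left Cstar_seminorm_scale[OF q] norm_divide)
    then show ?thesis using pos by (simp add: divide_eq_eq mult.commute)
  qed
  have "q (x * y) = q x * q y" for x y
  proof -
    have "(q (x * y))\<^sup>2 = q ((x * star x) * (y * star y))"
      by (simp add: Cstar_seminorm_square[OF q, symmetric] star_mult mult_ac)
    also have "\<dots> = q (x * star x) * q (y * star y)"
      by (rule qwx) (simp add: star_mult star_star mult.commute)
    also have "\<dots> = (q x * q y)\<^sup>2"
      by (simp add: Cstar_seminorm_square[OF q] power_mult_distrib)
    finally show ?thesis
      using Cstar_seminorm_nonneg[OF q] by (simp add: power2_eq_iff_nonneg)
  qed
  then show thesis using that q qp qh by blast
qed

section \<open>Gelfand-Mazur and the characters below a C*-seminorm\<close>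

text \<open>Gelfand--Mazur: if the minimum \<open>m\<close> of \<open>z \<mapsto> q (x - z)\<close> were positive, factoring
  \<open>x ^ 2 ^ k - z ^ 2 ^ k\<close> would show that this function is constant near every minimum point,
  hence equal to \<open>m\<close> everywhere, but it tends to infinity.\<close>

lemma multiplicative_seminorm_scalar:
  assumes sn: "seminorm scaleC q" and mult: "\<And>x y. q (x * y) = q x * q y" and one: "q 1 = 1"
  shows "\<exists>z. q (x - scaleC z 1) = 0"
proof -
  have norm1: "q (scaleC z 1) = cmod z" for z
    by (simp add: seminorm_scale[OF sn] one)
  have diff: "scaleC a 1 - scaleC b 1 = scaleC (a - b) 1" for a b
    by (simp add: scale_left_diff_distrib)
  define f where "f z = q (x - scaleC z 1)" for z
  have lip: "\<bar>f a - f b\<bar> \<le> cmod (a - b)" for a b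
    using seminorm_diff_abs[OF sn, of "x - scaleC a 1" "x - scaleC b 1"] norm1[of "b - a"]
    by (simp add: f_def norm_minus_commute flip: diff)
  \<comment> \<open>Outside the ball of radius \<open>2 * q x\<close>, \<open>f z\<close> is at
    least \<open>cmod z - q x\<close>, which exceeds \<open>q x = f 0\<close>; a minimum over the
    ball is therefore global.\<close>
  have "\<exists>z0\<in>cball 0 (2 * q x). \<forall>z\<in>cball 0 (2 * q x). f z0 \<le> f z"
  proof (rule continuous_attains_inf)
    have "1-lipschitz_on (cball 0 (2 * q x)) f"
      by (rule lipschitz_onI) (simp_all add: dist_norm lip)
    then show "continuous_on (cball 0 (2 * q x)) f"
      by (rule lipschitz_on_continuous_on)
  qed (simp_all add: seminorm_nonneg[OF sn] not_less)
  then obtain z0 where z0: "\<And>z. cmod z \<le> 2 * q x \<Longrightarrow> f z0 \<le> f z" by (metis mem_cball_0)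
  define m where "m = f z0"
  have large: "cmod z - q x \<le> f z" for z
    using seminorm_diff_triangle[OF sn, of x "x - scaleC z 1"] norm1[of z] by (simp add: f_def)
  have m: "m \<le> f z" for z
  proof (cases "cmod z \<le> 2 * q x")
    case False
    have "m \<le> f 0" unfolding m_def by (rule z0) (simp add: seminorm_nonneg[OF sn])
    then show ?thesis using False large[of z] by (simp add: f_def)
  qed (simp add: m_def z0)
  have m0: "0 \<le> m" by (simp add: m_def f_def seminorm_nonneg[OF sn])
  have "m = 0"
  proof (rule ccontr)
    assume "m \<noteq> 0"
    then have mpos: "0 < m" using m0 by simp
    have spread: "f (a + z) = m" if a: "f a = m" and z: "cmod z < m" for a z
    proof -
      define w where "w = x - scaleC a 1"
      have w: "q (w - scaleC b 1) = f (a + b)" for b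
        by (simp add: w_def f_def scale_left_distrib diff_diff_eq)
      \<comment> \<open>Repeated square roots of \<open>c\<close> split \<open>w ^ 2 ^ k - c\<close>
        into \<open>2 ^ k\<close> linear factors, each of seminorm at least
        \<open>m\<close>.\<close>
      have low: "m ^ 2 ^ k \<le> q (w ^ 2 ^ k - scaleC c 1)" for k c
      proof (induction k arbitrary: c)
        case 0
        then show ?case by (simp add: w m)
      next
        case (Suc k)
        define v where "v = w ^ 2 ^ k"
        have "csqrt c * csqrt c = c" by (simp flip: power2_eq_square)
        then have "scaleC c 1 = scaleC (csqrt c) 1 * scaleC (csqrt c) 1"
          by (simp add: scaleC_mult_left)
        then have "w ^ 2 ^ Suc k - scaleC c 1 = (v - scaleC (csqrt c) 1) * (v + scaleC (csqrt c) 1)"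
          by (simp add: v_def mult_2 power_add algebra_simps)
        also have "v + scaleC (csqrt c) 1 = v - scaleC (- csqrt c) 1" by simp
        finally have "q (w ^ 2 ^ Suc k - scaleC c 1) = q (v - scaleC (csqrt c) 1) * q (v - scaleC (- csqrt c) 1)"
          by (simp only: mult)
        moreover have "m ^ 2 ^ k * m ^ 2 ^ k \<le> \<dots>"
          unfolding v_def by (intro mult_mono Suc) (simp_all add: m0 seminorm_nonneg[OF sn])
        ultimately show ?case by (simp add: mult_2 power_add)
      qed
      have qpow: "q (y ^ n) = q y ^ n" for y n
        by (induction n) (simp_all add: mult one)
      have qw: "q w = m" using w[of 0] a by simp
      \<comment> \<open>One linear factor of \<open>w ^ 2 ^ k - z ^ 2 ^ k\<close> is
        \<open>w - z\<close>, of seminorm \<open>f (a + z)\<close>; the others have seminorm at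
        least \<open>m\<close>. The extra factor \<open>m\<close> on the right avoids the exponent
        \<open>2 ^ k - 1\<close>.\<close>
      have fac: "m ^ 2 ^ k * f (a + z) \<le> m * q (w ^ 2 ^ k - scaleC (z ^ 2 ^ k) 1)" for k
      proof (induction k)
        case 0
        then show ?case by (simp add: w)
      next
        case (Suc k)
        define v c where "v = w ^ 2 ^ k" and "c = z ^ 2 ^ k"
        have "w ^ 2 ^ Suc k - scaleC (z ^ 2 ^ Suc k) 1 = (v - scaleC c 1) * (v - scaleC (- c) 1)"
          by (simp add: v_def c_def mult_2 power_add algebra_simps scaleC_mult_left)
        then have "m * q (w ^ 2 ^ Suc k - scaleC (z ^ 2 ^ Suc k) 1)
            = (m * q (v - scaleC c 1)) * q (v - scaleC (- c) 1)"
          by (simp only: mult mult.assoc)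
        also have "\<dots> \<ge> (m ^ 2 ^ k * f (a + z)) * m ^ 2 ^ k"
          unfolding v_def c_def by (rule mult_mono[OF Suc low]) (simp_all add: m0 seminorm_nonneg[OF sn])
        finally show ?case by (simp add: mult_2 power_add mult_ac)
      qed
      have bound: "f (a + z) \<le> m * (1 + (cmod z / m) ^ 2 ^ k)" for k
      proof -
        have "q (w ^ 2 ^ k - scaleC (z ^ 2 ^ k) 1) \<le> m ^ 2 ^ k + cmod z ^ 2 ^ k"
          using seminorm_diff_triangle[OF sn, of "w ^ 2 ^ k" "scaleC (z ^ 2 ^ k) 1"]
          by (simp add: norm1 qpow qw norm_power)
        then have "m ^ 2 ^ k * f (a + z) \<le> m * (m ^ 2 ^ k + cmod z ^ 2 ^ k)"
          using fac[of k] mult_left_mono[OF _ m0] order_trans by blast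
        then show ?thesis using mpos by (simp add: field_simps)
      qed
      have "(\<lambda>n. (cmod z / m) ^ n) \<longlonglongrightarrow> 0"
        using z mpos by (intro LIMSEQ_realpow_zero) auto
      then have "(\<lambda>k. (cmod z / m) ^ 2 ^ k) \<longlonglongrightarrow> 0"
        using LIMSEQ_subseq_LIMSEQ[of "\<lambda>n. (cmod z / m) ^ n" 0 "\<lambda>k. 2 ^ k"]
        by (simp add: strict_mono_def o_def)
      then have "(\<lambda>k. m * (1 + (cmod z / m) ^ 2 ^ k)) \<longlonglongrightarrow> m * (1 + 0)"
        by (intro tendsto_intros)
      then have "f (a + z) \<le> m * (1 + 0)"
        by (rule LIMSEQ_le_const) (use bound in auto)
      then show ?thesis using m[of "a + z"] by simp
    qed
    \<comment> \<open>\<open>spread\<close> needs increments of modulus strictly below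
      \<open>m\<close>; steps of \<open>m / 2\<close> carry the value \<open>m\<close> arbitrarily
      far out, against \<open>large\<close>.\<close>
    have const: "f (z0 + of_nat n * of_real (m / 2)) = m" for n
    proof (induction n)
      case (Suc n)
      have "f (z0 + of_nat n * of_real (m / 2) + of_real (m / 2)) = m"
        using mpos by (intro spread[OF Suc]) (simp add: norm_divide)
      then show ?case by (simp add: algebra_simps add_divide_distrib)
    qed (simp add: m_def)
    obtain n :: nat where "m + q x + cmod z0 < of_nat n * (m / 2)"
      using reals_Archimedean3[of "m / 2"] mpos by (meson half_gt_zero)
    moreover have "of_nat n * (m / 2) = cmod (of_nat n * of_real (m / 2))"
      using mpos by (simp add: norm_mult norm_divide)
    moreover have "\<dots> \<le> cmod (z0 + of_nat n * of_real (m / 2)) + cmod z0"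
      using norm_triangle_ineq4[of "z0 + of_nat n * of_real (m / 2)" z0] by simp
    ultimately show False
      using large[of "z0 + of_nat n * of_real (m / 2)"] const[of n] by linarith
  qed
  then show ?thesis by (auto simp: m_def f_def)
qed

text \<open>The scalar \<open>z\<close> with \<open>q (x - scaleC z 1) = 0\<close> is unique because
  \<open>q (scaleC z 1) = cmod z\<close>. Each character law follows by checking that the expected
  value satisfies this equation.\<close>

lemma hermitian_character_of_multiplicative:
  assumes q: "Cstar_seminorm scaleC star q" and mult: "\<And>x y. q (x * y) = q x * q y" and one: "q 1 = 1"
  obtains \<phi> where "hermitian_character scaleC star \<phi>" "\<And>x. cmod (\<phi> x) = q x"
proof -
  note sn = Cstar_seminorm_seminorm[OF q]
  obtain \<phi> where \<phi>: "q (x - scaleC (\<phi> x) 1) = 0" for x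
    using multiplicative_seminorm_scalar[OF sn mult one] by metis
  have norm1: "q (scaleC z 1) = cmod z" for z
    by (simp add: seminorm_scale[OF sn] one)
  have unique: "\<phi> x = z" if "q (x - scaleC z 1) = 0" for x z
  proof -
    have "cmod (z - \<phi> x) = q ((x - scaleC (\<phi> x) 1) - (x - scaleC z 1))"
      by (simp add: scale_left_diff_distrib flip: norm1)
    also have "\<dots> \<le> 0" using seminorm_diff_triangle[OF sn] \<phi> that by (metis add_0)
    finally show ?thesis by simp
  qed
  have zero: "q x = 0" if "q x \<le> 0" for x
    using that seminorm_nonneg[OF sn, of x] by simp
  have add: "\<phi> (x + y) = \<phi> x + \<phi> y" for x y
  proof (intro unique zero)
    have eq: "x + y - scaleC (\<phi> x + \<phi> y) 1 = (x - scaleC (\<phi> x) 1) + (y - scaleC (\<phi> y) 1)"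
      by (simp add: scale_left_distrib)
    show "q (x + y - scaleC (\<phi> x + \<phi> y) 1) \<le> 0" unfolding eq
      using seminorm_triangle[OF sn, of "x - scaleC (\<phi> x) 1" "y - scaleC (\<phi> y) 1"] by (simp add: \<phi>)
  qed
  have scal: "\<phi> (scaleC c x) = c * \<phi> x" for c x
  proof (rule unique)
    have "scaleC c x - scaleC (c * \<phi> x) 1 = scaleC c (x - scaleC (\<phi> x) 1)"
      by (simp add: scale_right_diff_distrib)
    then show "q (scaleC c x - scaleC (c * \<phi> x) 1) = 0"
      by (simp add: seminorm_scale[OF sn] \<phi>)
  qed
  have mul: "\<phi> (x * y) = \<phi> x * \<phi> y" for x y
  proof (intro unique zero)
    have "x * y - scaleC (\<phi> x * \<phi> y) 1 = (x - scaleC (\<phi> x) 1) * y + scaleC (\<phi> x) (y - scaleC (\<phi> y) 1)"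
      by (simp add: scale_right_diff_distrib scaleC_mult_left left_diff_distrib)
    then show "q (x * y - scaleC (\<phi> x * \<phi> y) 1) \<le> 0"
      using seminorm_triangle[OF sn, of "(x - scaleC (\<phi> x) 1) * y" "scaleC (\<phi> x) (y - scaleC (\<phi> y) 1)"]
      by (simp add: \<phi> mult seminorm_scale[OF sn])
  qed
  have "\<phi> 1 = 1" by (rule unique) (simp add: seminorm_zero[OF sn])
  moreover have "\<phi> (star x) = cnj (\<phi> x)" for x
  proof (rule unique)
    have "star x - scaleC (cnj (\<phi> x)) 1 = star (x - scaleC (\<phi> x) 1)"
      by (simp add: star_diff star_scaleC star_one)
    then show "q (star x - scaleC (cnj (\<phi> x)) 1) = 0"
      by (simp add: Cstar_seminorm_star[OF q] \<phi>)
  qed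
  moreover have "Vector_Spaces.linear scaleC (*) \<phi>"
    by unfold_locales (simp_all add: add scal algebra_simps)
  moreover have "cmod (\<phi> x) = q x" for x
    using seminorm_diff_abs[OF sn, of x "scaleC (\<phi> x) 1"] \<phi>[of x] norm1 by simp
  ultimately show thesis using that mul by (auto simp: hermitian_character_def)
qed

text \<open>The multiplicative seminorm is obtained at the normalized selfadjoint element
  \<open>h = x * star x / (p x)\<^sup>2\<close>; there \<open>q h = 1\<close> amounts to
  \<open>q x = p x\<close>.\<close>

lemma Cstar_seminorm_character:
  assumes p: "Cstar_seminorm scaleC star p" and x: "p x \<noteq> 0"
  obtains \<phi> where "hermitian_character scaleC star \<phi>" "\<And>y. cmod (\<phi> y) \<le> p y" "cmod (\<phi> x) = p x"
proof -
  have pos: "0 < p x" using x Cstar_seminorm_nonneg[OF p, of x] by simp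
  define h where "h = scaleC (of_real (1 / (p x)\<^sup>2)) (x * star x)"
  have h: "star h = h" "p h = 1"
    using pos by (simp_all add: h_def star_scaleC star_mult star_star mult.commute
        Cstar_seminorm_scale[OF p] Cstar_seminorm_square[OF p] norm_divide norm_power)
  obtain q where q: "Cstar_seminorm scaleC star q" "q \<le> p" "q h = 1"
    and mult: "\<And>x y. q (x * y) = q x * q y"
    using Cstar_seminorm_multiplicative[OF p h] by metis
  have "q 1 = 1" using mult[of h 1] q(3) by simp
  then obtain \<phi> where \<phi>: "hermitian_character scaleC star \<phi>" "\<And>x. cmod (\<phi> x) = q x"
    using hermitian_character_of_multiplicative[OF q(1) mult] by metis
  have "q h = (q x)\<^sup>2 / (p x)\<^sup>2"
    by (simp add: h_def Cstar_seminorm_scale[OF q(1)] Cstar_seminorm_square[OF q(1)]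
        norm_divide norm_power)
  then have "(q x)\<^sup>2 = (p x)\<^sup>2" using q(3) pos by (simp add: divide_eq_eq)
  then have "q x = p x"
    by (rule power2_eq_imp_eq) (simp_all add: Cstar_seminorm_nonneg[OF q(1)] Cstar_seminorm_nonneg[OF p])
  then show thesis using that \<phi> q(2) by (simp add: le_fun_def)
qed

end

section \<open>Seminorm topologies and spaces of characters\<close>

lemma open_vimage_coordinate:
  fixes W :: "'b::topological_space set"
  shows "open W \<Longrightarrow> open {h :: 'a \<Rightarrow> 'b. h x \<in> W}"
  using open_vimage[of W "\<lambda>h. h x"] by (simp add: vimage_def)

instance "fun" :: (type, t0_space) t0_space
proof
  fix f g :: "'a \<Rightarrow> 'b"
  assume "f \<noteq> g"
  then obtain x where "f x \<noteq> g x" by auto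
  then obtain U where "open U" "\<not> (f x \<in> U \<longleftrightarrow> g x \<in> U)"
    using separation_t0[of "f x" "g x"] by blast
  then show "\<exists>U. open U \<and> \<not> (f \<in> U \<longleftrightarrow> g \<in> U)"
    by (intro exI[of _ "{h. h x \<in> U}"]) (simp add: open_vimage_coordinate)
qed

instance "fun" :: (type, t1_space) t1_space
proof
  fix f g :: "'a \<Rightarrow> 'b"
  assume "f \<noteq> g"
  then obtain x where "f x \<noteq> g x" by auto
  then obtain U where "open U" "f x \<in> U" "g x \<notin> U"
    using separation_t1[of "f x" "g x"] by blast
  then show "\<exists>U. open U \<and> f \<in> U \<and> g \<notin> U"
    by (intro exI[of _ "{h. h x \<in> U}"]) (simp add: open_vimage_coordinate)
qed

text \<open>Hausdorffness makes compact sets of characters closed, which is used to glue continuous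
  functions on them, and it is the setting of the Stone-Weierstrass theorem.\<close>

instance "fun" :: (type, t2_space) t2_space
proof
  fix f g :: "'a \<Rightarrow> 'b"
  assume "f \<noteq> g"
  then obtain x where "f x \<noteq> g x" by auto
  then obtain U V where "open U" "open V" "f x \<in> U" "g x \<in> V" "U \<inter> V = {}"
    using hausdorff[of "f x" "g x"] by blast
  then show "\<exists>U V. open U \<and> open V \<and> f \<in> U \<and> g \<in> V \<and> U \<inter> V = {}"
    by (intro exI[of _ "{h. h x \<in> U}"] exI[of _ "{h. h x \<in> V}"]) (auto simp: open_vimage_coordinate)
qed

section \<open>Topologies generated by seminorms\<close>

lemma topspace_seminorm_topology: "topspace (seminorm_topology P) = UNIV"
  by (simp add: seminorm_topology_def)

lemma openin_seminorm_topology_ball: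
  "p \<in> P \<Longrightarrow> 0 < r \<Longrightarrow> openin (seminorm_topology P) {y. p (y - x) < r}"
  unfolding seminorm_topology_def by (intro topology_generated_by_Basis insertI2) blast

text \<open>Subtraction of \<open>x\<close> is continuous, since it pulls the subbasic ball around
  \<open>a\<close> back to the one around \<open>x + a\<close>.\<close>

lemma openin_seminorm_topology_translate:
  assumes "openin (seminorm_topology P) U"
  shows "openin (seminorm_topology P) {y. y - x \<in> U}"
proof -
  have "continuous_map (seminorm_topology P) (seminorm_topology P) (\<lambda>y. y - x)"
  proof (subst (2) seminorm_topology_def, rule continuous_on_generated_topo)
    fix U assume "U \<in> insert UNIV {{y. p (y - x) < r} |p x r. p \<in> P \<and> 0 < r}"
    then consider "U = UNIV" | p a r where "p \<in> P" "0 < r" "U = {y. p (y - a) < r}" by auto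
    then show "openin (seminorm_topology P) ((\<lambda>y. y - x) -` U \<inter> topspace (seminorm_topology P))"
    proof cases
      case 1
      then show ?thesis using openin_topspace by simp
    next
      case 2
      then show ?thesis
        using openin_seminorm_topology_ball[OF 2(1,2), of "x + a"]
        by (simp add: topspace_seminorm_topology vimage_def diff_diff_eq)
    qed
  qed auto
  from openin_continuous_map_preimage[OF this assms] show ?thesis
    by (simp add: topspace_seminorm_topology)
qed

text \<open>Here \<open>q\<close> may lie outside the generating family: continuity makes the ball
  around 0 open, and translation moves it to \<open>x\<close>.\<close>

lemma openin_ball_of_continuous:
  assumes "continuous_map (seminorm_topology P) euclideanreal q"
  shows "openin (seminorm_topology P) {y. q (y - x) < r}"
  using openin_seminorm_topology_translate[OF openin_continuous_map_preimage[OF assms, of "{..<r}"], of x]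
  by (simp add: topspace_seminorm_topology)

text \<open>Serves two cases: \<open>f\<close> a seminorm, with \<open>q = f\<close> and the reverse
  triangle inequality, and \<open>f\<close> a character bounded by a continuous seminorm
  \<open>q\<close>.\<close>

lemma continuous_map_of_dominated:
  fixes f :: "'a::ab_group_add \<Rightarrow> 'b::metric_space"
  assumes ball: "\<And>x r. 0 < r \<Longrightarrow> openin T {y. q (y - x) < r}" and q0: "q 0 = (0::real)"
    and dom: "\<And>x y. dist (f y) (f x) \<le> q (y - x)"
  shows "continuous_map T euclidean f"
  unfolding continuous_map_def
proof (intro conjI allI impI)
  fix U :: "'b set" assume "openin euclidean U"
  show "openin T {x \<in> topspace T. f x \<in> U}"
  proof (subst openin_subopen, intro ballI)
    fix x assume "x \<in> {x \<in> topspace T. f x \<in> U}"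
    then obtain r where r: "0 < r" "ball (f x) r \<subseteq> U"
      using \<open>openin euclidean U\<close> by (auto simp: open_contains_ball)
    have "{y. q (y - x) < r} \<subseteq> {x \<in> topspace T. f x \<in> U}"
    proof
      fix y assume y: "y \<in> {y. q (y - x) < r}"
      then have "f y \<in> ball (f x) r" using dom[of y x] by (simp add: dist_commute)
      then show "y \<in> {x \<in> topspace T. f x \<in> U}"
        using r y openin_subset[OF ball[OF r(1)]] by blast
    qed
    then show "\<exists>V. openin T V \<and> x \<in> V \<and> V \<subseteq> {x \<in> topspace T. f x \<in> U}"
      using ball[OF r(1), of x] r(1) q0 by (intro exI[of _ "{y. q (y - x) < r}"]) simp
  qed
qed auto

section \<open>Supremum seminorms and compact sets of characters\<close>

lemma sup_seminorm_upper:
  "bdd_above ((\<lambda>\<phi>. cmod (\<phi> a)) ` K) \<Longrightarrow> \<phi> \<in> K \<Longrightarrow> cmod (\<phi> a) \<le> sup_seminorm K a"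
  unfolding sup_seminorm_def by (rule cSup_upper) auto

lemma sup_seminorm_least:
  "0 \<le> b \<Longrightarrow> (\<And>\<phi>. \<phi> \<in> K \<Longrightarrow> cmod (\<phi> a) \<le> b) \<Longrightarrow> sup_seminorm K a \<le> b"
  unfolding sup_seminorm_def by (rule cSup_least) auto

lemma sup_seminorm_nonneg:
  "bdd_above ((\<lambda>\<phi>. cmod (\<phi> a)) ` K) \<Longrightarrow> 0 \<le> sup_seminorm K a"
  unfolding sup_seminorm_def by (rule cSup_upper) auto

text \<open>For negative \<open>r\<close> and empty \<open>K\<close> the inserted 0 would make only
  the left side true.\<close>

lemma less_sup_seminorm_iff:
  assumes "bdd_above ((\<lambda>\<phi>. cmod (\<phi> a)) ` K)" "0 \<le> r"
  shows "r < sup_seminorm K a \<longleftrightarrow> (\<exists>\<phi>\<in>K. r < cmod (\<phi> a))"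
  unfolding sup_seminorm_def using assms by (subst less_cSup_iff) auto

lemma compact_bdd_above_cmod:
  fixes K :: "('a \<Rightarrow> complex) set"
  assumes "compact K"
  shows "bdd_above ((\<lambda>\<phi>. cmod (\<phi> a)) ` K)"
  by (intro bounded_imp_bdd_above compact_imp_bounded compact_continuous_image assms continuous_intros)
    (rule continuous_on_subset[OF continuous_on_product_coordinates], simp)

lemma lower_semicontinuous_sup_seminorm:
  assumes T: "topspace T = UNIV"
    and bdd: "\<And>a. bdd_above ((\<lambda>\<phi>. cmod (\<phi> a)) ` K)"
    and cont: "\<And>\<phi>. \<phi> \<in> K \<Longrightarrow> continuous_map T euclidean \<phi>"
  shows "lower_semicontinuous T (sup_seminorm K)"
  unfolding lower_semicontinuous_def
proof
  fix r
  show "openin T {x \<in> topspace T. r < sup_seminorm K x}"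
  proof (cases "0 \<le> r")
    case True
    have "openin T {x \<in> topspace T. \<phi> x \<in> - cball 0 r}" if "\<phi> \<in> K" for \<phi>
      by (rule openin_continuous_map_preimage[OF cont[OF that]]) (simp add: open_Compl)
    then have "openin T (\<Union>\<phi>\<in>K. {x \<in> topspace T. \<phi> x \<in> - cball 0 r})" by blast
    moreover have "(\<Union>\<phi>\<in>K. {x \<in> topspace T. \<phi> x \<in> - cball 0 r}) = {x \<in> topspace T. r < sup_seminorm K x}"
      by (auto simp: T less_sup_seminorm_iff[OF bdd True] not_le)
    ultimately show ?thesis by simp
  next
    case False
    then have "r < sup_seminorm K x" for x
      using sup_seminorm_nonneg[OF bdd, of x] by simp
    then show ?thesis using openin_topspace[of T] by (simp add: T)
  qed
qed

text \<open>This is \<open>K\<^sub>p\<close>. Continuity of the characters is not demanded, so the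
  set is compact for every \<open>p\<close>.\<close>

definition characters_below ::
    "(complex \<Rightarrow> 'a::{comm_ring, comm_monoid_mult} \<Rightarrow> 'a) \<Rightarrow> ('a \<Rightarrow> 'a) \<Rightarrow> ('a \<Rightarrow> real) \<Rightarrow> ('a \<Rightarrow> complex) set"
  where "characters_below scaleC star p =
    {\<phi>. hermitian_character scaleC star \<phi> \<and> (\<forall>x. cmod (\<phi> x) \<le> p x)}"

lemma compactin_character_space:
  "compactin (character_space scaleC star) K \<longleftrightarrow>
    compact K \<and> K \<subseteq> {\<phi>. hermitian_character scaleC star \<phi>}"
  by (auto simp: character_space_def euclidean_product_topology compactin_subtopology)

lemma compactin_continuous_character_space:
  "compactin (continuous_character_space scaleC star T) K \<longleftrightarrow>
    compact K \<and> K \<subseteq> continuous_characters scaleC star T"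
  by (auto simp: continuous_character_space_def compactin_subtopology compactin_character_space
      continuous_characters_def)

context involutive_algebra
begin

text \<open>Linearity is spelled out as equations between coordinates of \<open>\<phi>\<close>, from
  which closedness in the pointwise topology can be read off.\<close>

lemma hermitian_character_iff:
  "hermitian_character scaleC star \<phi> \<longleftrightarrow>
    (\<forall>x y. \<phi> (x + y) = \<phi> x + \<phi> y) \<and> (\<forall>c x. \<phi> (scaleC c x) = c * \<phi> x) \<and>
    (\<forall>x y. \<phi> (x * y) = \<phi> x * \<phi> y) \<and> \<phi> 1 = 1 \<and> (\<forall>x. \<phi> (star x) = cnj (\<phi> x))"
proof -
  have "Vector_Spaces.linear scaleC (*) \<phi> \<longleftrightarrow>
      (\<forall>x y. \<phi> (x + y) = \<phi> x + \<phi> y) \<and> (\<forall>c x. \<phi> (scaleC c x) = c * \<phi> x)"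
  proof
    assume "Vector_Spaces.linear scaleC (*) \<phi>"
    then interpret l: Vector_Spaces.linear scaleC "(*)" \<phi> .
    show "(\<forall>x y. \<phi> (x + y) = \<phi> x + \<phi> y) \<and> (\<forall>c x. \<phi> (scaleC c x) = c * \<phi> x)"
      by (simp add: l.add l.scale)
  next
    assume "(\<forall>x y. \<phi> (x + y) = \<phi> x + \<phi> y) \<and> (\<forall>c x. \<phi> (scaleC c x) = c * \<phi> x)"
    then show "Vector_Spaces.linear scaleC (*) \<phi>"
      by unfold_locales (simp_all add: algebra_simps)
  qed
  then show ?thesis by (simp add: hermitian_character_def)
qed

lemma hermitian_characterD:
  assumes "hermitian_character scaleC star \<phi>"
  shows "\<phi> (x + y) = \<phi> x + \<phi> y" "\<phi> (scaleC c x) = c * \<phi> x" "\<phi> (x * y) = \<phi> x * \<phi> y"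
    "\<phi> 1 = 1" "\<phi> (star x) = cnj (\<phi> x)" "\<phi> (x - y) = \<phi> x - \<phi> y"
proof -
  show *: "\<phi> (x + y) = \<phi> x + \<phi> y" "\<phi> (scaleC c x) = c * \<phi> x" "\<phi> (x * y) = \<phi> x * \<phi> y"
    "\<phi> 1 = 1" "\<phi> (star x) = cnj (\<phi> x)" for x y c
    using assms by (auto simp: hermitian_character_iff)
  show "\<phi> (x - y) = \<phi> x - \<phi> y" using *(1)[of "x - y" y] by simp
qed

text \<open>Tychonoff: the set is the closed set of hermitian characters intersected with a product
  of compact discs of radius \<open>p x\<close>.\<close>

lemma compact_characters_below: "compact (characters_below scaleC star p)"
proof -
  have "compactin (product_topology (\<lambda>_. euclidean) UNIV) (PiE UNIV (\<lambda>x. cball (0::complex) (p x)))"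
    by (simp add: compactin_PiE)
  then have "compact (PiE UNIV (\<lambda>x. cball (0::complex) (p x)))"
    by (simp add: euclidean_product_topology)
  moreover have "closed {\<phi>. hermitian_character scaleC star \<phi>}"
    unfolding hermitian_character_iff
    by (intro closed_Collect_conj closed_Collect_all closed_Collect_eq continuous_intros
        continuous_on_product_coordinates)
  ultimately have "compact (PiE UNIV (\<lambda>x. cball (0::complex) (p x)) \<inter> {\<phi>. hermitian_character scaleC star \<phi>})"
    by (rule compact_Int_closed)
  also have "PiE UNIV (\<lambda>x. cball (0::complex) (p x)) \<inter> {\<phi>. hermitian_character scaleC star \<phi>}
      = characters_below scaleC star p"
    by (auto simp: characters_below_def PiE_def Pi_def)
  finally show ?thesis .
qed

lemma Cstar_seminorm_sup_seminorm:
  assumes K: "K \<subseteq> {\<phi>. hermitian_character scaleC star \<phi>}"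
    and bdd: "\<And>a. bdd_above ((\<lambda>\<phi>. cmod (\<phi> a)) ` K)"
  shows "Cstar_seminorm scaleC star (sup_seminorm K)"
proof -
  let ?s = "sup_seminorm K"
  note up = sup_seminorm_upper[OF bdd] and nn = sup_seminorm_nonneg[OF bdd]
  have H: "\<phi> \<in> K \<Longrightarrow> hermitian_character scaleC star \<phi>" for \<phi> using K by auto
  note h = hermitian_characterD[OF H]
  have "?s (x + y) \<le> ?s x + ?s y" for x y
  proof (rule sup_seminorm_least)
    fix \<phi> assume \<phi>: "\<phi> \<in> K"
    show "cmod (\<phi> (x + y)) \<le> ?s x + ?s y"
      unfolding h(1)[OF \<phi>] by (rule norm_triangle_mono[OF up[OF \<phi>] up[OF \<phi>]])
  qed (simp add: nn)
  moreover have "?s (scaleC c x) = cmod c * ?s x" for c x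
  proof (rule antisym)
    show "?s (scaleC c x) \<le> cmod c * ?s x"
      by (rule sup_seminorm_least) (simp_all add: nn h norm_mult mult_left_mono up)
    show "cmod c * ?s x \<le> ?s (scaleC c x)"
    proof (cases "c = 0")
      case True
      then show ?thesis by (simp add: nn)
    next
      case False
      have "?s x \<le> ?s (scaleC c x) / cmod c"
      proof (rule sup_seminorm_least)
        fix \<phi> assume \<phi>: "\<phi> \<in> K"
        show "cmod (\<phi> x) \<le> ?s (scaleC c x) / cmod c"
          using up[OF \<phi>, of "scaleC c x"] False
          by (simp add: h(2)[OF \<phi>] norm_mult pos_le_divide_eq mult.commute)
      qed (simp add: nn)
      then show ?thesis using False by (simp add: pos_le_divide_eq mult.commute)
    qed
  qed
  moreover have "?s (x * star x) = (?s x)\<^sup>2" for x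
  proof (rule antisym)
    have sq: "cmod (\<phi> (x * star x)) = (cmod (\<phi> x))\<^sup>2" if "\<phi> \<in> K" for \<phi>
      by (simp add: h[OF that] norm_mult power2_eq_square)
    show "?s (x * star x) \<le> (?s x)\<^sup>2"
      by (rule sup_seminorm_least) (simp_all add: sq power_mono up)
    have "?s x \<le> sqrt (?s (x * star x))"
    proof (rule sup_seminorm_least)
      fix \<phi> assume \<phi>: "\<phi> \<in> K"
      show "cmod (\<phi> x) \<le> sqrt (?s (x * star x))"
        by (rule real_le_rsqrt) (use up[OF \<phi>, of "x * star x"] sq[OF \<phi>] in simp)
    qed (simp add: nn)
    then have "(?s x)\<^sup>2 \<le> (sqrt (?s (x * star x)))\<^sup>2"
      by (rule power_mono) (rule nn)
    then show "(?s x)\<^sup>2 \<le> ?s (x * star x)" by (simp add: nn)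
  qed
  ultimately show ?thesis by (simp add: Cstar_seminorm_def seminorm_def nn)
qed

text \<open>A nonzero value \<open>p x\<close> is attained at a character below \<open>p\<close>, so
  estimates of \<open>p\<close> can be checked one character at a time.\<close>

lemma Cstar_seminorm_leI:
  assumes p: "Cstar_seminorm scaleC star p" and "0 \<le> b"
    and "\<And>\<phi>. \<phi> \<in> characters_below scaleC star p \<Longrightarrow> cmod (\<phi> x) \<le> b"
  shows "p x \<le> b"
proof (cases "p x = 0")
  case False
  then obtain \<phi> where "hermitian_character scaleC star \<phi>" "\<And>y. cmod (\<phi> y) \<le> p y" "cmod (\<phi> x) = p x"
    using Cstar_seminorm_character[OF p] by blast
  then show ?thesis using assms(3)[of \<phi>] by (simp add: characters_below_def)
qed (simp add: assms)

lemma Cstar_seminorm_eq_sup_seminorm: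
  assumes p: "Cstar_seminorm scaleC star p"
  shows "p = sup_seminorm (characters_below scaleC star p)"
proof (rule ext, rule antisym)
  note bdd = compact_bdd_above_cmod[OF compact_characters_below]
  show "p x \<le> sup_seminorm (characters_below scaleC star p) x" for x
    by (rule Cstar_seminorm_leI[OF p]) (auto intro: sup_seminorm_nonneg sup_seminorm_upper bdd)
  show "sup_seminorm (characters_below scaleC star p) x \<le> p x" for x
    by (rule sup_seminorm_least) (auto simp: Cstar_seminorm_nonneg[OF p] characters_below_def)
qed

text \<open>With this, one seminorm controls a finite intersection of balls.\<close>

lemma Cstar_seminorm_max:
  assumes p: "Cstar_seminorm scaleC star p" and q: "Cstar_seminorm scaleC star q"
  shows "Cstar_seminorm scaleC star (\<lambda>x. max (p x) (q x))"
proof -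
  have "max (p (x + y)) (q (x + y)) \<le> max (p x) (q x) + max (p y) (q y)" for x y
    using Cstar_seminorm_triangle[OF p, of x y] Cstar_seminorm_triangle[OF q, of x y] by auto
  moreover have "max (p (x * star x)) (q (x * star x)) = (max (p x) (q x))\<^sup>2" for x
    using power_mono[of "p x" "q x" 2] power_mono[of "q x" "p x" 2]
      Cstar_seminorm_nonneg[OF p, of x] Cstar_seminorm_nonneg[OF q, of x]
    by (cases "p x \<le> q x")
      (simp_all add: Cstar_seminorm_square[OF p] Cstar_seminorm_square[OF q] max_absorb1 max_absorb2)
  ultimately show ?thesis
    using Cstar_seminorm_nonneg[OF p]
    by (auto simp: Cstar_seminorm_def seminorm_def Cstar_seminorm_scale[OF p] Cstar_seminorm_scale[OF q]
        max_mult_distrib_left le_max_iff_disj)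
qed

section \<open>Neighbourhoods, continuous characters and approximation\<close>

lemma continuous_seminorm_topology:
  assumes P: "\<And>p. p \<in> P \<Longrightarrow> seminorm scaleC p" and p: "p \<in> P"
  shows "continuous_map (seminorm_topology P) euclideanreal p"
  by (rule continuous_map_of_dominated[where q = p, OF openin_seminorm_topology_ball[OF p]])
    (simp_all add: seminorm_zero[OF P[OF p]] seminorm_diff_abs[OF P[OF p]] dist_real_def)

text \<open>Subbasic balls may be centred elsewhere and belong to different seminorms. The triangle
  inequality recentres them at \<open>x\<close>, and maxima merge the seminorms.\<close>

lemma seminorm_topology_neighbourhood:
  assumes P: "\<And>p. p \<in> P \<Longrightarrow> Cstar_seminorm scaleC star p"
    and U: "openin (seminorm_topology P) U" and x: "x \<in> U"
  obtains q e where "Cstar_seminorm scaleC star q" "continuous_map (seminorm_topology P) euclideanreal q"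
    "0 < e" "\<And>y. q (y - x) < e \<Longrightarrow> y \<in> U"
proof -
  let ?T = "seminorm_topology P"
  have "\<forall>x\<in>U. \<exists>q e. Cstar_seminorm scaleC star q \<and> continuous_map ?T euclideanreal q \<and>
      0 < e \<and> (\<forall>y. q (y - x) < e \<longrightarrow> y \<in> U)"
    using openin_topology_generated_by[OF U[unfolded seminorm_topology_def]]
  proof (induction rule: generate_topology_on.induct)
    case Empty
    then show ?case by simp
  next
    case (Int a b)
    show ?case
    proof
      fix x assume "x \<in> a \<inter> b"
      then obtain q e r d where qe: "Cstar_seminorm scaleC star q" "continuous_map ?T euclideanreal q"
          "0 < e" "\<forall>y. q (y - x) < e \<longrightarrow> y \<in> a"
        and rd: "Cstar_seminorm scaleC star r" "continuous_map ?T euclideanreal r"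
          "0 < d" "\<forall>y. r (y - x) < d \<longrightarrow> y \<in> b"
        using Int.IH by (metis IntD1 IntD2)
      show "\<exists>q e. Cstar_seminorm scaleC star q \<and> continuous_map ?T euclideanreal q \<and>
          0 < e \<and> (\<forall>y. q (y - x) < e \<longrightarrow> y \<in> a \<inter> b)"
        using qe rd Cstar_seminorm_max[OF qe(1) rd(1)] continuous_map_real_max[OF qe(2) rd(2)]
        by (intro exI[of _ "\<lambda>x. max (q x) (r x)"] exI[of _ "min e d"]) auto
    qed
  next
    case (UN K)
    show ?case
    proof
      fix x assume "x \<in> \<Union>K"
      then obtain k where "k \<in> K" "x \<in> k" by auto
      then show "\<exists>q e. Cstar_seminorm scaleC star q \<and> continuous_map ?T euclideanreal q \<and>
          0 < e \<and> (\<forall>y. q (y - x) < e \<longrightarrow> y \<in> \<Union>K)"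
        using UN.IH[of k] by (meson UnionI)
    qed
  next
    case (Basis s)
    then consider "s = UNIV" | p a r where "p \<in> P" "0 < r" "s = {y. p (y - a) < r}" by auto
    then show ?case
    proof cases
      case 1
      \<comment> \<open>The zero seminorm handles the whole space, also when \<open>P\<close> is
        empty.\<close>
      have "Cstar_seminorm scaleC star (\<lambda>_. 0)" by (simp add: Cstar_seminorm_def seminorm_def)
      then show ?thesis using 1 by (intro ballI exI[of _ "\<lambda>_. 0"] exI[of _ 1]) auto
    next
      case 2
      note sn = Cstar_seminorm_seminorm[OF P]
      show ?thesis
      proof
        fix x assume x: "x \<in> s"
        have "y \<in> s" if "p (y - x) < r - p (x - a)" for y
          using seminorm_triangle[OF sn[OF 2(1)], of "y - x" "x - a"] that 2(3) by simp
        then show "\<exists>q e. Cstar_seminorm scaleC star q \<and> continuous_map ?T euclideanreal q \<and>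
          0 < e \<and> (\<forall>y. q (y - x) < e \<longrightarrow> y \<in> s)"
          using P[OF 2(1)] continuous_seminorm_topology[OF sn 2(1)] 2(3) x
          by (intro exI[of _ p] exI[of _ "r - p (x - a)"]) auto
      qed
    qed
  qed
  then show thesis using that x by blast
qed

lemma hermitian_character_continuous:
  assumes q: "Cstar_seminorm scaleC star q" and cont: "continuous_map (seminorm_topology P) euclideanreal q"
    and "hermitian_character scaleC star \<phi>" "\<And>x. cmod (\<phi> x) \<le> q x"
  shows "\<phi> \<in> continuous_characters scaleC star (seminorm_topology P)"
proof -
  have "continuous_map (seminorm_topology P) euclidean \<phi>"
    by (rule continuous_map_of_dominated[where q = q, OF openin_ball_of_continuous[OF cont]])
      (simp_all add: seminorm_zero[OF Cstar_seminorm_seminorm[OF q]] dist_norm assms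
        flip: hermitian_characterD(6)[OF assms(3)])
  then show ?thesis using assms by (simp add: continuous_characters_def)
qed

text \<open>Stone--Weierstrass, applied to the function that is \<open>1\<close> on \<open>K\<^sub>q\<close> and \<open>1 / max 1 \<bar>x\<bar>\<close> on
  \<open>K\<^sub>p\<close>; the hypothesis on \<open>K\<^sub>p \<inter> K\<^sub>q\<close> makes it well defined.\<close>

lemma Cstar_seminorm_truncation:
  assumes p: "Cstar_seminorm scaleC star p" and q: "Cstar_seminorm scaleC star q"
    and le: "\<And>\<phi>. \<phi> \<in> characters_below scaleC star p \<Longrightarrow> \<phi> \<in> characters_below scaleC star q \<Longrightarrow> cmod (\<phi> x) \<le> 1"
    and d: "0 < d"
  obtains y where "p (x * y) \<le> 1 + d * p x" "q (x * y - x) \<le> d * q x"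
proof -
  define Kp Kq where "Kp = characters_below scaleC star p" and "Kq = characters_below scaleC star q"
  define w where "w \<phi> = (if \<phi> \<in> Kq then 1 else 1 / max 1 (cmod (\<phi> x)))" for \<phi>
  have comp: "compact Kp" "compact Kq" by (simp_all add: Kp_def Kq_def compact_characters_below)
  have ev: "continuous_on S (\<lambda>\<phi>. \<phi> a)" for S and a :: 'a
    by (rule continuous_on_subset[OF continuous_on_product_coordinates]) simp
  have H: "hermitian_character scaleC star \<phi>" if "\<phi> \<in> Kq \<union> Kp" for \<phi>
    using that by (auto simp: Kp_def Kq_def characters_below_def)
  note h = hermitian_characterD[OF H]
  have real: "Im (\<phi> y) = 0" if "star y = y" "\<phi> \<in> Kq \<union> Kp" for \<phi> y
    using h(5)[OF that(2), of y] that(1) by (simp add: complex_eq_iff)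
  have "continuous_on (Kq \<union> Kp) w"
    unfolding w_def
  proof (rule continuous_on_cases)
    show "closed Kq" "closed Kp" using comp by (auto intro: compact_imp_closed)
    show "continuous_on Kp (\<lambda>\<phi>. 1 / max 1 (cmod (\<phi> x)))"
      by (intro continuous_intros ev) auto
    show "\<forall>\<phi>. \<phi> \<in> Kq \<and> \<phi> \<notin> Kq \<or> \<phi> \<in> Kp \<and> \<phi> \<in> Kq \<longrightarrow> 1 = 1 / max 1 (cmod (\<phi> x))"
      using le by (auto simp: Kp_def Kq_def max_absorb1)
  qed simp
  \<comment> \<open>Selfadjoint elements take real values at hermitian characters, so these
    functions form the real algebra that Stone-Weierstrass requires.\<close>
  define Q where "Q f \<longleftrightarrow> (\<exists>y. star y = y \<and> (\<forall>\<phi>\<in>Kq \<union> Kp. f \<phi> = Re (\<phi> y)))" for f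
  have "\<exists>g. Q g \<and> (\<forall>\<phi>\<in>Kq \<union> Kp. \<bar>w \<phi> - g \<phi>\<bar> < d)"
  proof (rule Stone_Weierstrass_HOL)
    show "compact (Kq \<union> Kp)" using comp by (rule compact_Un[rotated])
    show "Q (\<lambda>_. c)" for c
      unfolding Q_def
      by (rule exI[of _ "scaleC (of_real c) 1"]) (simp add: star_scaleC star_one h)
    show "continuous_on (Kq \<union> Kp) f" if "Q f" for f
    proof -
      from that obtain y where y: "\<forall>\<phi>\<in>Kq \<union> Kp. f \<phi> = Re (\<phi> y)" by (auto simp: Q_def)
      have "continuous_on (Kq \<union> Kp) (\<lambda>\<phi>. Re (\<phi> y))" by (intro continuous_intros ev)
      then show ?thesis using y by (simp cong: continuous_on_cong_simp)
    qed
    show "Q (\<lambda>\<phi>. f \<phi> + g \<phi>)" if "Q f \<and> Q g" for f g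
    proof -
      from that obtain y z where "star y = y" "\<forall>\<phi>\<in>Kq \<union> Kp. f \<phi> = Re (\<phi> y)"
        "star z = z" "\<forall>\<phi>\<in>Kq \<union> Kp. g \<phi> = Re (\<phi> z)" by (auto simp: Q_def)
      then show ?thesis unfolding Q_def by (intro exI[of _ "y + z"]) (simp add: star_add h)
    qed
    show "Q (\<lambda>\<phi>. f \<phi> * g \<phi>)" if "Q f \<and> Q g" for f g
    proof -
      from that obtain y z where "star y = y" "\<forall>\<phi>\<in>Kq \<union> Kp. f \<phi> = Re (\<phi> y)"
        "star z = z" "\<forall>\<phi>\<in>Kq \<union> Kp. g \<phi> = Re (\<phi> z)" by (auto simp: Q_def)
      then show ?thesis
        unfolding Q_def by (intro exI[of _ "y * z"]) (simp add: star_mult mult.commute h real)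
    qed
    show "\<exists>f. Q f \<and> f \<phi> \<noteq> f \<psi>" if "\<phi> \<in> Kq \<union> Kp \<and> \<psi> \<in> Kq \<union> Kp \<and> \<phi> \<noteq> \<psi>" for \<phi> \<psi>
    proof -
      from that obtain a where a: "\<phi> a \<noteq> \<psi> a" by auto
      have Q: "Q (\<lambda>\<phi>. Re (\<phi> y))" if "star y = y" for y
        using that by (auto simp: Q_def)
      \<comment> \<open>At a character \<open>\<phi>\<close> these elements take the values
        \<open>2 * Re (\<phi> a)\<close> and \<open>2 * Im (\<phi> a)\<close>.\<close>
      let ?y = "a + star a" and ?z = "scaleC \<i> (star a - a)"
      have "star ?y = ?y" "star ?z = ?z"
        by (simp_all add: star_add star_diff star_star star_scaleC add.commute scale_right_diff_distrib)
      moreover have "Re (\<phi> ?y) \<noteq> Re (\<psi> ?y) \<or> Re (\<phi> ?z) \<noteq> Re (\<psi> ?z)"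
        using a that by (auto simp: h complex_eq_iff)
      ultimately show ?thesis using Q by metis
    qed
  qed fact+
  then obtain y where y: "star y = y" and close: "\<And>\<phi>. \<phi> \<in> Kq \<union> Kp \<Longrightarrow> \<bar>w \<phi> - Re (\<phi> y)\<bar> < d"
    unfolding Q_def by auto
  \<comment> \<open>Multiplication by \<open>x\<close> turns the uniform error \<open>d\<close> into
    one relative to \<open>cmod (\<phi> x)\<close>.\<close>
  have diff: "cmod (\<phi> (x * y) - \<phi> x * of_real (w \<phi>)) \<le> d * cmod (\<phi> x)" if "\<phi> \<in> Kq \<union> Kp" for \<phi>
  proof -
    have "\<phi> (x * y) - \<phi> x * of_real (w \<phi>) = \<phi> x * of_real (Re (\<phi> y) - w \<phi>)"
      using real[OF y that] by (simp add: h[OF that] complex_eq_iff algebra_simps)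
    then have "cmod (\<phi> (x * y) - \<phi> x * of_real (w \<phi>)) = cmod (\<phi> x) * \<bar>w \<phi> - Re (\<phi> y)\<bar>"
      by (simp only: norm_mult norm_of_real abs_minus_commute)
    also have "\<dots> \<le> cmod (\<phi> x) * d"
      using close[OF that] by (intro mult_left_mono) auto
    finally show ?thesis by (simp add: mult.commute)
  qed
  show thesis
  proof (rule that)
    show "p (x * y) \<le> 1 + d * p x"
    proof (rule Cstar_seminorm_leI[OF p])
      fix \<phi> assume "\<phi> \<in> characters_below scaleC star p"
      then have \<phi>: "\<phi> \<in> Kp" "\<phi> \<in> Kq \<union> Kp" "cmod (\<phi> x) \<le> p x"
        by (auto simp: Kp_def characters_below_def)
      \<comment> \<open>On \<open>Kq\<close> this is the hypothesis \<open>le\<close>; off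
        \<open>Kq\<close> the denominator of \<open>w\<close> cuts the value down.\<close>
      have "cmod (\<phi> x * of_real (w \<phi>)) \<le> 1"
        using le[of \<phi>] \<phi> by (auto simp: w_def norm_mult norm_divide Kp_def Kq_def max_def)
      moreover have "d * cmod (\<phi> x) \<le> d * p x" using d \<phi> by simp
      ultimately show "cmod (\<phi> (x * y)) \<le> 1 + d * p x"
        using norm_triangle_sub[of "\<phi> (x * y)" "\<phi> x * of_real (w \<phi>)"] diff[OF \<phi>(2)] by linarith
    qed (use d Cstar_seminorm_nonneg[OF p, of x] in simp)
    show "q (x * y - x) \<le> d * q x"
    proof (rule Cstar_seminorm_leI[OF q])
      fix \<phi> assume "\<phi> \<in> characters_below scaleC star q"
      then have \<phi>: "\<phi> \<in> Kq" "\<phi> \<in> Kq \<union> Kp" "cmod (\<phi> x) \<le> q x"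
        by (auto simp: Kq_def characters_below_def)
      have "d * cmod (\<phi> x) \<le> d * q x" using d \<phi> by simp
      then show "cmod (\<phi> (x * y - x)) \<le> d * q x"
        using diff[OF \<phi>(2)] \<phi>(1) by (simp add: w_def h(6)[OF \<phi>(2)])
    qed (use d Cstar_seminorm_nonneg[OF q, of x] in simp)
  qed
qed

text \<open>If \<open>p x\<close> exceeded 1, lower semicontinuity would keep \<open>p\<close> well
  above 1 on some \<open>q\<close>-ball around \<open>x\<close>, but the truncation
  \<open>x * y\<close> lies in that ball and has \<open>p\<close> nearly bounded by 1.\<close>

lemma lower_semicontinuous_le_1:
  assumes P: "\<And>p. p \<in> P \<Longrightarrow> Cstar_seminorm scaleC star p" and T: "T = seminorm_topology P"
    and p: "Cstar_seminorm scaleC star p" and lsc: "lower_semicontinuous T p"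
    and le: "\<And>\<phi>. \<phi> \<in> characters_below scaleC star p \<Longrightarrow> \<phi> \<in> continuous_characters scaleC star T \<Longrightarrow> cmod (\<phi> x) \<le> 1"
  shows "p x \<le> 1"
proof (rule ccontr)
  assume "\<not> ?thesis"
  then have gt: "1 < p x" by simp
  \<comment> \<open>Then \<open>1 + d * p x\<close> is the midpoint of 1 and
    \<open>p x\<close>.\<close>
  define d where "d = (p x - 1) / (2 * p x)"
  have d: "0 < d" "1 + d * p x < p x" using gt by (simp_all add: d_def field_simps)
  let ?U = "{z \<in> topspace T. 1 + d * p x < p z}"
  have xU: "openin (seminorm_topology P) ?U" "x \<in> ?U"
    using lsc d by (simp_all add: lower_semicontinuous_def T topspace_seminorm_topology)
  obtain q e where q: "Cstar_seminorm scaleC star q" "continuous_map T euclideanreal q"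
    and e: "0 < e" and U: "\<And>y. q (y - x) < e \<Longrightarrow> y \<in> ?U"
    unfolding T by (rule seminorm_topology_neighbourhood[OF P xU[unfolded T]]) blast+
  have q0: "0 \<le> q x" by (rule Cstar_seminorm_nonneg[OF q(1)])
  \<comment> \<open>The added 1 keeps the quotient meaningful when \<open>q x = 0\<close> and makes
    \<open>c * q x < e\<close> strict.\<close>
  define c where "c = min d (e / (q x + 1))"
  have c: "0 < c" "c \<le> d" using d e q0 by (auto simp: c_def)
  have "c * q x \<le> e / (q x + 1) * q x" using q0 by (intro mult_right_mono) (auto simp: c_def)
  also have "\<dots> < e" using e q0 by (simp add: field_simps)
  finally have ce: "c * q x < e" .
  obtain y where y: "p (x * y) \<le> 1 + c * p x" "q (x * y - x) \<le> c * q x"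
  proof (rule Cstar_seminorm_truncation[OF p q(1) _ c(1)])
    fix \<phi> assume "\<phi> \<in> characters_below scaleC star p" "\<phi> \<in> characters_below scaleC star q"
    \<comment> \<open>A character below the continuous seminorm \<open>q\<close> is continuous, so
      the hypothesis on continuous characters covers the whole intersection.\<close>
    moreover from this(2) have "\<phi> \<in> continuous_characters scaleC star T"
      using hermitian_character_continuous[OF q(1) q(2)[unfolded T]] by (simp add: characters_below_def T)
    ultimately show "cmod (\<phi> x) \<le> 1" by (intro le)
  qed
  have "c * p x \<le> d * p x" using c gt by simp
  then show False using U[of "x * y"] y ce by simp
qed

end

section \<open>The characterization of C*-barrelled algebras\<close>

theorem theorem4p2:
  fixes scaleC :: "complex \<Rightarrow> 'a::{comm_ring, comm_monoid_mult} \<Rightarrow> 'a"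
    and star :: "'a \<Rightarrow> 'a"
    and T :: "'a topology"
  assumes "LCstar_algebra scaleC star T"
  shows "Cstar_barrelled scaleC star T \<longleftrightarrow>
    k_closedin (character_space scaleC star) (continuous_characters scaleC star T) \<and>
    T = compact_convergence_topology scaleC star T"
proof -
  interpret involutive_algebra scaleC star
    using assms by (simp add: LCstar_algebra_def)
  obtain P where P: "\<And>p. p \<in> P \<Longrightarrow> Cstar_seminorm scaleC star p" and T: "T = seminorm_topology P"
    using assms by (auto simp: LCstar_algebra_def)
  have top: "topspace T = UNIV" by (simp add: T topspace_seminorm_topology)
  let ?H = "{\<phi>. hermitian_character scaleC star \<phi>}" and ?C = "continuous_characters scaleC star T"
  have CH: "?C \<subseteq> ?H" by (auto simp: continuous_characters_def)
  define Q where "Q = {sup_seminorm K | K. compactin (continuous_character_space scaleC star T) K}"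
  have Qdef: "compact_convergence_topology scaleC star T = seminorm_topology Q"
    by (simp add: compact_convergence_topology_def Q_def)
  have Q: "Cstar_seminorm scaleC star p" if "p \<in> Q" for p
    using that CH
    by (auto simp: Q_def compactin_continuous_character_space
        intro!: Cstar_seminorm_sup_seminorm compact_bdd_above_cmod)
  have dominated: "\<phi> \<in> ?C" if "Cstar_seminorm scaleC star q" "continuous_map T euclideanreal q"
    "\<phi> \<in> characters_below scaleC star q" for q \<phi>
    using hermitian_character_continuous[OF that(1) that(2)[unfolded T]] that(3)
    by (simp add: characters_below_def T)
  show ?thesis
  proof (intro iffI conjI)
    assume barrelled: "Cstar_barrelled scaleC star T"
    have cont: "continuous_map T euclideanreal (sup_seminorm S)" "Cstar_seminorm scaleC star (sup_seminorm S)"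
      if S: "S \<subseteq> ?C" and bdd: "\<And>a. bdd_above ((\<lambda>\<phi>. cmod (\<phi> a)) ` S)" for S
    proof -
      show "Cstar_seminorm scaleC star (sup_seminorm S)"
        using S CH by (intro Cstar_seminorm_sup_seminorm bdd) auto
      moreover have "lower_semicontinuous T (sup_seminorm S)"
        using S by (intro lower_semicontinuous_sup_seminorm top bdd) (auto simp: continuous_characters_def)
      ultimately show "continuous_map T euclideanreal (sup_seminorm S)"
        using barrelled by (simp add: Cstar_barrelled_def)
    qed
    show "k_closedin (character_space scaleC star) ?C"
      unfolding k_closedin_def
    proof (intro conjI allI impI)
      show "?C \<subseteq> topspace (character_space scaleC star)"
        using CH by (simp add: character_space_def)
      fix K assume "compactin (character_space scaleC star) K"
      then have K: "compact K" "K \<subseteq> ?H" by (auto simp: compactin_character_space)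
      let ?S = "?C \<inter> K" and ?p = "sup_seminorm (?C \<inter> K)"
      have bdd: "bdd_above ((\<lambda>\<phi>. cmod (\<phi> a)) ` ?S)" for a
        by (rule bdd_above_mono[OF compact_bdd_above_cmod[OF K(1)]]) auto
      note p = cont[OF _ bdd, simplified]
      \<comment> \<open>Barrelledness makes \<open>?p\<close> continuous, so every character in
        \<open>K\<close> bounded by \<open>?p\<close> is continuous. Membership thereby becomes a
        pointwise closed condition.\<close>
      have "?S = K \<inter> {\<phi>. \<forall>a. cmod (\<phi> a) \<le> ?p a}"
        using K(2) dominated[OF p(2,1)] sup_seminorm_upper[OF bdd]
        by (auto simp: characters_below_def)
      moreover have "closed {\<phi>. \<forall>a. cmod (\<phi> a) \<le> ?p a}"
        by (intro closed_Collect_all closed_Collect_le continuous_intros continuous_on_product_coordinates)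
      ultimately show "closedin (subtopology (character_space scaleC star) K) ?S"
        using K(2) closedin_subtopology_Int_closedin
        by (auto simp: character_space_def euclidean_product_topology subtopology_subtopology
            Int_absorb1 closedin_closed)
    qed
    show "T = compact_convergence_topology scaleC star T"
      unfolding Qdef
    proof (rule topology_eq[THEN iffD2], intro allI iffI)
      fix U
      \<comment> \<open>Each generator of \<open>T\<close> is the supremum seminorm of the compact
        set of characters below it, all of them continuous.\<close>
      have "P \<subseteq> Q"
      proof
        fix p assume p: "p \<in> P"
        have "characters_below scaleC star p \<subseteq> ?C"
          using dominated[OF P[OF p]] continuous_seminorm_topology[OF Cstar_seminorm_seminorm[OF P] p]
          by (auto simp: T)
        then show "p \<in> Q"
          using Cstar_seminorm_eq_sup_seminorm[OF P[OF p]] compact_characters_below[of p]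
          unfolding Q_def compactin_continuous_character_space by blast
      qed
      moreover assume "openin T U"
      ultimately show "openin (seminorm_topology Q) U"
        unfolding T seminorm_topology_def openin_topology_generated_by_iff[of "insert UNIV {{y. p (y - x) < r} |p x r. p \<in> P \<and> 0 < r}"]
        by (rule_tac generate_topology_on_coarsest[OF istopology_openin])
          (auto intro!: topology_generated_by_Basis)
    next
      fix U assume "openin (seminorm_topology Q) U"
      then show "openin T U"
        unfolding seminorm_topology_def openin_topology_generated_by_iff
      proof (rule generate_topology_on_coarsest[OF istopology_openin, rotated])
        fix s assume "s \<in> insert UNIV {{y. p (y - x) < r} |p x r. p \<in> Q \<and> 0 < r}"
        then consider "s = UNIV" | p x r where "p \<in> Q" "s = {y. p (y - x) < r}" by auto
        then show "openin T s"
        proof cases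
          case 1
          then show ?thesis using openin_topspace[of T] by (simp add: top)
        next
          case 2
          \<comment> \<open>Compact sets of continuous characters are pointwise bounded, so
            barrelledness applies to their supremum seminorms.\<close>
          then have "continuous_map T euclideanreal p"
            by (auto simp: Q_def compactin_continuous_character_space compact_bdd_above_cmod cont)
          then show ?thesis using openin_ball_of_continuous 2 unfolding T by blast
        qed
      qed
    qed
  next
    assume "k_closedin (character_space scaleC star) ?C \<and> T = compact_convergence_topology scaleC star T"
    then have k: "k_closedin (character_space scaleC star) ?C" and TQ: "T = seminorm_topology Q"
      by (auto simp: Qdef)
    show "Cstar_barrelled scaleC star T"
      unfolding Cstar_barrelled_def
    proof (intro allI impI)
      fix p assume "Cstar_seminorm scaleC star p \<and> lower_semicontinuous T p"
      then have p: "Cstar_seminorm scaleC star p" and lsc: "lower_semicontinuous T p" by auto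
      let ?K = "characters_below scaleC star p"
      let ?L = "?C \<inter> ?K"
      have "compactin (character_space scaleC star) ?K"
        unfolding compactin_character_space
        using compact_characters_below by (auto simp: characters_below_def)
      \<comment> \<open>Condition (a), tested on the compact set \<open>?K\<close>, makes
        \<open>?L\<close> compact; its supremum seminorm is then one of the generators in
        (b).\<close>
      moreover from this have "closedin (subtopology (character_space scaleC star) ?K) ?L"
        using k by (simp add: k_closedin_def)
      ultimately have "compactin (character_space scaleC star) ?L"
        by (metis closedin_compact_space compact_space_subtopology compactin_subtopology)
      then have L: "compact ?L" by (simp add: compactin_character_space)
      note bdd = compact_bdd_above_cmod[OF L]
      have "sup_seminorm ?L \<in> Q"
        using L by (auto simp: Q_def compactin_continuous_character_space)
      then have cont: "continuous_map T euclideanreal (sup_seminorm ?L)"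
        using continuous_seminorm_topology[OF Cstar_seminorm_seminorm[OF Q]] by (simp add: TQ)
      have "p x = sup_seminorm ?L x" for x
      proof (rule antisym)
        show "sup_seminorm ?L x \<le> p x"
          by (rule sup_seminorm_least) (auto simp: Cstar_seminorm_nonneg[OF p] characters_below_def)
        show "p x \<le> sup_seminorm ?L x"
        \<comment> \<open>Rescaling by some \<open>t\<close> strictly above the supremum avoids
          division by a supremum that may be 0.\<close>
        proof (rule dense_ge)
          fix t assume t: "sup_seminorm ?L x < t"
          then have t0: "0 < t" using sup_seminorm_nonneg[OF bdd, of x] by simp
          have "p (scaleC (of_real (1 / t)) x) \<le> 1"
          proof (rule lower_semicontinuous_le_1[OF P T p lsc])
            fix \<phi> assume \<phi>: "\<phi> \<in> ?K" "\<phi> \<in> ?C"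
            then have "cmod (\<phi> x) \<le> t"
              using sup_seminorm_upper[OF bdd, of \<phi> x] t by simp
            moreover have "\<phi> (scaleC (of_real (1 / t)) x) = of_real (1 / t) * \<phi> x"
              using \<phi> CH by (intro hermitian_characterD) auto
            ultimately show "cmod (\<phi> (scaleC (of_real (1 / t)) x)) \<le> 1"
              using t0 by (simp add: norm_mult norm_divide)
          qed
          then show "p x \<le> t"
            using t0 by (simp add: Cstar_seminorm_scale[OF p] norm_divide)
        qed
      qed
      then have "p = sup_seminorm ?L" by (rule ext)
      then show "continuous_map T euclideanreal p" using cont by metis
    qed
  qed
qed

end
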